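(* Let $n\ge 1$ and let $\mathcal{K}\subseteq\mathcal{S}^n$ be any closed convex cone with $\mathcal{DD}_+^n\subseteq\mathcal{K}\subseteq\mathcal{N}^n$. Then the following strict inclusions among faces of $\mathcal{K}$ hold: $$\mathcal{K}[\mathcal{I}_{n,n}]\subsetneq\mathcal{K}[\mathcal{I}_{n-1,n-1}]\subsetneq\mathcal{K}[\mathcal{I}_{n-1,n}]\subsetneq\mathcal{K}[\mathcal{I}_{n-2,n-2}]\subsetneq\cdots\subsetneq\mathcal{K}[\mathcal{I}_{2,n}]\subsetneq\mathcal{K}[\mathcal{I}_{1,1}]\subsetneq\cdots\subsetneq\mathcal{K}[\mathcal{I}_{1,n-1}]\subsetneq\mathcal{K}[\mathcal{I}_{1,n}]\subsetneq\mathcal{K}[\mathcal{I}_{0,0}]=\mathcal{K},$$ that is, $\mathcal{K}[\mathcal{I}_{i,j}]\subsetneq\mathcal{K}[\mathcal{I}_{i,j+1}]$ for all $i=1,\dots,n$ and $j=i,\dots,n$, where $\mathcal{I}_{i,n+1}:=\mathcal{I}_{i-1,i-1}$. In particular, $\ell_{\mathcal{K}}=T_n+1$.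
   Context: $\mathcal{S}^n$ is the space of real $n\times n$ symmetric matrices and $T_n:=\frac{n(n+1)}{2}$. A set $\mathcal{K}\subseteq\mathcal{S}^n$ is a cone if $\alpha A\in\mathcal{K}$ for all $\alpha\ge 0$ and $A\in\mathcal{K}$. $\mathcal{N}^n$ is the set of matrices in $\mathcal{S}^n$ with only nonnegative elements. $\mathcal{DD}^n:=\{A\in\mathcal{S}^n : A_{ii}\ge\sum_{j\ne i}|A_{ij}|\text{ for all } i=1,\dots,n\}$ and $\mathcal{DD}_+^n:=\mathcal{DD}^n\cap\mathcal{N}^n$. For $i=1,\dots,n$ and $j=i,\dots,n$, let $$\mathcal{I}_{i,j}:=\bigcup_{k=1}^{i-1}\bigcup_{l=k}^{n}\{(k,l)\}\cup\bigcup_{l=j}^{n}\{(i,l)\},$$ and let $\mathcal{I}_{0,0}:=\emptyset$ and $\mathcal{I}_{i,n+1}:=\mathcal{I}_{i-1,i-1}$ for $i=1,\dots,n$. For a set $\mathcal{I}$ of index pairs, $\mathcal{K}[\mathcal{I}]:=\{A\in\mathcal{K} : A_{ij}=0\text{ for all }(i,j)\in\mathcal{I}\}$. A nonempty convex subcone $\mathcal{F}$ of a closed convex cone $\mathcal{K}$ is a face of $\mathcal{K}$ if for any $A,B\in\mathcal{K}$, $A+B\in\mathcal{F}$ implies $A,B\in\mathcal{F}$. A chain of faces of $\mathcal{K}$ of length $l$ is a sequence $\mathcal{F}_l\subsetneq\cdots\subsetneq\mathcal{F}_1$ in which every $\mathcal{F}_i$ is a face of $\mathcal{K}$. $\ell_{\mathcal{K}}$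 denotes the length of the longest chain of faces of $\mathcal{K}$. *)

theory Defs
  imports "HOL-Analysis.Analysis" "HOL-Library.Extended_Nat"
begin

definition sym_matrices :: "(real ^ 'n ^ 'n) set" where
  "sym_matrices = {A. transpose A = A}"

definition nonneg_matrices :: "(real ^ 'n ^ 'n) set" where
  "nonneg_matrices = {A \<in> sym_matrices. \<forall>i j. 0 \<le> A $ i $ j}"

definition diag_dominant :: "(real ^ 'n::finite ^ 'n) set" where
  "diag_dominant = {A \<in> sym_matrices. \<forall>i. (\<Sum>j \<in> UNIV - {i}. \<bar>A $ i $ j\<bar>) \<le> A $ i $ i}"

definition nonneg_diag_dominant :: "(real ^ 'n::finite ^ 'n) set" where
  "nonneg_diag_dominant = diag_dominant \<inter> nonneg_matrices"

text \<open>
  The index sets \<open>I\<^sub>i\<^sub>,\<^sub>j\<close> for matrices of order \<open>n\<close>. They are used only for \<open>1 \<le> i \<le> n\<close> and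
  \<open>i \<le> j \<le> n + 1\<close>, and for \<open>i = j = 0\<close>. The second equation has row number \<open>i + 1\<close>, so the
  rows before it are \<open>1, \<dots>, i\<close>, and its first branch is the convention
  \<open>I\<^sub>i\<^sub>+\<^sub>1\<^sub>,\<^sub>n\<^sub>+\<^sub>1 = I\<^sub>i\<^sub>,\<^sub>i\<close>.
\<close>
primrec index_set :: "nat \<Rightarrow> nat \<Rightarrow> nat \<Rightarrow> (nat \<times> nat) set" where
  "index_set n 0 j = {}"
| "index_set n (Suc i) j =
     (if j = n + 1 then index_set n i i
      else (\<Union>k \<in> {1..i}. \<Union>l \<in> {k..n}. {(k, l)}) \<union> (\<Union>l \<in> {j..n}. {(Suc i, l)}))"

text \<open>
  Rows and columns are indexed by the finite type \<open>'n\<close>; \<open>e\<close> numbers its elements \<open>1, \<dots>, n\<close>, so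
  that \<open>A $ e i $ e j\<close> is the entry of \<open>A\<close> in position \<open>(i, j)\<close>.
\<close>
definition vanishing_on ::
    "(nat \<Rightarrow> 'n) \<Rightarrow> (real ^ 'n ^ 'n) set \<Rightarrow> (nat \<times> nat) set \<Rightarrow> (real ^ 'n ^ 'n) set" where
  "vanishing_on e K I = {A \<in> K. \<forall>(i, j) \<in> I. A $ e i $ e j = 0}"

definition cone_face :: "'a::real_vector set \<Rightarrow> 'a set \<Rightarrow> bool" where
  "cone_face F K \<longleftrightarrow> F \<noteq> {} \<and> F \<subseteq> K \<and> convex F \<and> cone F \<and>
     (\<forall>A \<in> K. \<forall>B \<in> K. A + B \<in> F \<longrightarrow> A \<in> F \<and> B \<in> F)"

definition face_chain :: "'a::real_vector set \<Rightarrow> nat \<Rightarrow> (nat \<Rightarrow> 'a set) \<Rightarrow> bool" where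
  "face_chain K l F \<longleftrightarrow>
     (\<forall>i \<in> {1..l}. cone_face (F i) K) \<and> (\<forall>i \<in> {1..<l}. F (i + 1) \<subset> F i)"

text \<open>
  The supremum is taken in \<^typ>\<open>enat\<close>, so that it is \<open>\<infinity>\<close> if there are arbitrarily long chains;
  a finite value is the length of an actual longest chain.
\<close>
definition longest_face_chain :: "'a::real_vector set \<Rightarrow> enat" where
  "longest_face_chain K = Sup {enat l | l. \<exists>F. face_chain K l F}"

end

theory Submission
  imports Defs
begin

text \<open>
  Between nonnegative matrices, prescribing zeros cuts out faces. The inclusions are strict because
  the all-ones block on the rows and columns \<open>i\<close>, \<open>j\<close> is nonnegative and diagonally dominant.
  Conversely, the dimension drops strictly along any chain of faces, so that no chain is longer
  than \<open>dim \<S>\<^sup>n + 1\<close>.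
\<close>

section \<open>Zero patterns, the faces they cut out, and strict inclusions\<close>

lemma index_set_eq:
  assumes "1 \<le> i" "i \<le> n" "i \<le> j" "j \<le> n + 1"
  shows "index_set n i j = {(k, l). 1 \<le> k \<and> k \<le> l \<and> l \<le> n \<and> (k < i \<or> k = i \<and> j \<le> l)}"
proof -
  obtain i' where i': "i = Suc i'"
    using assms(1) by (cases i) auto
  \<comment> \<open>For \<open>j = n + 1\<close> the alternative
    \<open>k = i \<and> j \<le> l\<close> is void, so the closed form leaves just the rows before
    \<open>i\<close>, as the convention demands. Later arguments then need not separate steps within
    a row from steps across rows.\<close>
  show ?thesis
  proof (cases "j = n + 1")
    case True
    show ?thesis
    proof (cases i')
      case 0
      then show ?thesis using True i' by auto
    next
      case (Suc m)
      have "i' \<noteq> n + 1" using i' assms by simp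
      then show ?thesis using True i' Suc by auto
    qed
  next
    case False
    then show ?thesis using i' assms by auto
  qed
qed

lemma vanishing_on_empty: "vanishing_on e K {} = K"
  by (simp add: vanishing_on_def)

lemma cone_face_vanishing_on:
  fixes K :: "(real ^ 'n::finite ^ 'n) set"
  assumes "convex K" "cone K" "K \<noteq> {}" "K \<subseteq> nonneg_matrices"
  shows "cone_face (vanishing_on e K I) K"
  unfolding cone_face_def
proof (intro conjI ballI impI)
  have "0 \<in> K"
    using assms by (simp add: cone_contains_0)
  then show "vanishing_on e K I \<noteq> {}"
    by (auto simp: vanishing_on_def)
  show "vanishing_on e K I \<subseteq> K"
    by (auto simp: vanishing_on_def)
  show "convex (vanishing_on e K I)"
    using assms(1) by (fastforce simp: convex_def vanishing_on_def)
  show "cone (vanishing_on e K I)"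
    using assms(2) by (fastforce simp: cone_def vanishing_on_def)
next
  fix A B
  assume AB: "A \<in> K" "B \<in> K" "A + B \<in> vanishing_on e K I"
  have "A $ e i $ e j = 0 \<and> B $ e i $ e j = 0" if "(i, j) \<in> I" for i j
  proof -
    have "A $ e i $ e j + B $ e i $ e j = 0"
      using AB(3) that by (auto simp: vanishing_on_def)
    moreover have "0 \<le> A $ e i $ e j" "0 \<le> B $ e i $ e j"
      using AB assms(4) by (auto simp: nonneg_matrices_def)
    ultimately show ?thesis by linarith
  qed
  then show "A \<in> vanishing_on e K I" "B \<in> vanishing_on e K I"
    using AB by (auto simp: vanishing_on_def)
qed

text \<open>This is v v^T for v the indicator vector of {x, y}. If x = y it is a single diagonal
  unit, so one formula serves diagonal and off-diagonal positions.\<close>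

definition ones_block :: "'n \<Rightarrow> 'n \<Rightarrow> real ^ 'n::finite ^ 'n" where
  "ones_block x y = (\<chi> a b. of_bool (a \<in> {x, y} \<and> b \<in> {x, y}))"

lemma ones_block_in_nonneg_diag_dominant: "ones_block x y \<in> nonneg_diag_dominant"
proof -
  have "(\<Sum>b \<in> UNIV - {a}. \<bar>ones_block x y $ a $ b\<bar>) \<le> ones_block x y $ a $ a" for a
  proof (cases "a \<in> {x, y}")
    case True
    have "(\<Sum>b \<in> UNIV - {a}. \<bar>ones_block x y $ a $ b\<bar>)
        = (\<Sum>b \<in> UNIV - {a}. if b \<in> {x, y} then 1 else 0)"
      using True by (intro sum.cong) (auto simp: ones_block_def)
    also have "\<dots> = real (card ((UNIV - {a}) \<inter> {x, y}))"
      by (subst sum.inter_restrict [symmetric]) auto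
    \<comment> \<open>Besides a itself, {x, y} has at most one element; the singleton bounds the sum
      by 1, the diagonal entry.\<close>
    also have "\<dots> \<le> real (card {if a = x then y else x})"
      using True by (intro of_nat_mono card_mono) auto
    finally show ?thesis
      using True by (auto simp: ones_block_def)
  qed (auto simp: ones_block_def)
  then show ?thesis
    by (auto simp: nonneg_diag_dominant_def diag_dominant_def nonneg_matrices_def
        sym_matrices_def ones_block_def transpose_def vec_eq_iff)
qed

text \<open>On and above the diagonal, the block on i \<le> j is nonzero only at (i,i), (i,j) and
  (j,j). None of these lies before row i or in row i beyond column j, whereas (i,j) belongs to the
  larger index set.\<close>

lemma vanishing_on_index_set_psubset:
  fixes K :: "(real ^ 'n::finite ^ 'n) set"
  assumes e: "inj_on e {1..n}" and K: "nonneg_diag_dominant \<subseteq> K"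
    and ij: "1 \<le> i" "i \<le> j" "j \<le> n"
  shows "vanishing_on e K (index_set n i j) \<subset> vanishing_on e K (index_set n i (j + 1))"
proof -
  have I: "index_set n i j = {(k, l). 1 \<le> k \<and> k \<le> l \<and> l \<le> n \<and> (k < i \<or> k = i \<and> j \<le> l)}"
    and I': "index_set n i (j + 1)
      = {(k, l). 1 \<le> k \<and> k \<le> l \<and> l \<le> n \<and> (k < i \<or> k = i \<and> j + 1 \<le> l)}"
    using ij by (intro index_set_eq; simp)+
  let ?A = "ones_block (e i) (e j)"
  have eq: "e k = e l \<longleftrightarrow> k = l" if "k \<in> {1..n}" "l \<in> {1..n}" for k l
    using e that by (auto simp: inj_on_eq_iff)
  have "?A $ e k $ e l = 0" if "(k, l) \<in> index_set n i (j + 1)" for k l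
  proof -
    have kl: "k \<in> {1..n}" "l \<in> {1..n}" "k \<le> l" "k < i \<or> k = i \<and> j + 1 \<le> l"
      using that unfolding I' by auto
    have "i \<in> {1..n}" "j \<in> {1..n}" using ij by auto
    then have "e k \<in> {e i, e j} \<longleftrightarrow> k \<in> {i, j}" "e l \<in> {e i, e j} \<longleftrightarrow> l \<in> {i, j}"
      using kl(1,2) by (auto simp: eq)
    then show ?thesis
      using kl ij by (auto simp: ones_block_def)
  qed
  then have "?A \<in> vanishing_on e K (index_set n i (j + 1))"
    using subsetD[OF K ones_block_in_nonneg_diag_dominant] by (auto simp: vanishing_on_def)
  moreover have "?A \<notin> vanishing_on e K (index_set n i j)"
  proof -
    have "(i, j) \<in> index_set n i j" using ij unfolding I by auto
    moreover have "?A $ e i $ e j \<noteq> 0" by (simp add: ones_block_def)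
    ultimately show ?thesis by (auto simp: vanishing_on_def)
  qed
  moreover have "vanishing_on e K (index_set n i j) \<subseteq> vanishing_on e K (index_set n i (j + 1))"
    unfolding I I' by (auto simp: vanishing_on_def)
  ultimately show ?thesis by blast
qed

section \<open>A chain with T_n + 1 faces\<close>

lemma face_chain_extend:
  assumes "face_chain K l F" "cone_face G K" "G \<subset> F l"
  shows "face_chain K (Suc l) (F(Suc l := G))"
  using assms by (auto simp: face_chain_def less_Suc_eq le_Suc_eq)

lemma face_chain_index_set:
  fixes K :: "(real ^ 'n::finite ^ 'n) set"
  assumes face: "\<And>I. cone_face (vanishing_on e K I) K"
    and psubset: "\<And>i j. \<lbrakk>1 \<le> i; i \<le> j; j \<le> n\<rbrakk> \<Longrightarrow>
      vanishing_on e K (index_set n i j) \<subset> vanishing_on e K (index_set n i (j + 1))"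
    and "i \<le> n"
  shows "\<exists>F. face_chain K (Suc (\<Sum>k<i. n - k)) F \<and>
    F (Suc (\<Sum>k<i. n - k)) = vanishing_on e K (index_set n i i)"
  using \<open>i \<le> n\<close>
\<comment> \<open>The chain starts with K at position 1, hence the \<open>Suc\<close>; row k + 1
  then adds n - k faces.\<close>
proof (induction i)
  case 0
  have "face_chain K 1 (\<lambda>_. K)"
    using face[of "{}"] by (simp add: face_chain_def vanishing_on_empty)
  then show ?case
    by (auto simp: vanishing_on_empty)
next
  case (Suc i)
  let ?l = "Suc (\<Sum>k<i. n - k)"
  \<comment> \<open>Here d counts the columns of row i + 1 already zeroed, from right to left. At d
    = 0 the column n + 1 stands for the end of the previous row; at d = n - i the diagonal is
    reached.\<close>
  have "\<exists>F. face_chain K (?l + d) F \<and>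
      F (?l + d) = vanishing_on e K (index_set n (Suc i) (n + 1 - d))" if "d \<le> n - i" for d
    using that
  proof (induction d)
    case 0
    then show ?case using Suc by auto
  next
    case (Suc d)
    let ?G = "vanishing_on e K (index_set n (Suc i) (n + 1 - Suc d))"
    obtain F where F: "face_chain K (?l + d) F"
      "F (?l + d) = vanishing_on e K (index_set n (Suc i) (n + 1 - d))"
      using Suc by auto
    have "n + 1 - d = (n + 1 - Suc d) + 1"
      using Suc.prems by simp
    then have "?G \<subset> F (?l + d)"
      using psubset[of "Suc i" "n + 1 - Suc d"] Suc.prems F(2) by simp
    from face_chain_extend[OF F(1) face this] show ?case
      by (intro exI[of _ "F(Suc (?l + d) := ?G)"]) (simp only: add_Suc_right fun_upd_same)
  qed
  from this[of "n - i"] show ?case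
    using Suc.prems by (simp add: Suc_diff_le)
qed

section \<open>Upper bound on the length of chains by dimension\<close>

lemma cone_face_imp_face_of:
  assumes "cone K" "cone_face F K"
  shows "F face_of K"
  unfolding face_of_def
proof (intro conjI ballI impI)
  show "F \<subseteq> K" "convex F"
    using assms(2) by (auto simp: cone_face_def)
  fix a b x
  assume ab: "a \<in> K" "b \<in> K" "x \<in> F" "x \<in> open_segment a b"
  then obtain u where u: "0 < u" "u < 1" "x = (1 - u) *\<^sub>R a + u *\<^sub>R b"
    by (auto simp: in_segment)
  \<comment> \<open>A convex combination in a cone is a sum of two members of the cone, to which the
    face property for sums applies; afterwards the positive weights are scaled away.\<close>
  have "(1 - u) *\<^sub>R a \<in> K" "u *\<^sub>R b \<in> K"
    using ab u assms(1) by (auto simp: cone_def)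
  then have "(1 - u) *\<^sub>R a \<in> F" "u *\<^sub>R b \<in> F"
    using assms(2) ab(3) u(3) by (auto simp: cone_face_def)
  moreover have "z \<in> F" if "c *\<^sub>R z \<in> F" "0 < c" for c z
  proof -
    have "inverse c *\<^sub>R c *\<^sub>R z \<in> F"
      using assms(2) that unfolding cone_face_def cone_def
      by (meson inverse_nonnegative_iff_nonnegative less_imp_le)
    then show ?thesis using that(2) by simp
  qed
  ultimately show "a \<in> F" "b \<in> F"
    using u by (meson diff_gt_0_iff_gt)+
qed

text \<open>A face of K contained in another face of K is a face of it, and a proper face of a
  convex set has smaller affine dimension. So each step of the chain costs at least one
  dimension.\<close>

lemma face_chain_aff_dim:
  fixes K :: "'a::euclidean_space set"
  assumes "cone K" "face_chain K l F" "1 \<le> m" "m \<le> l"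
  shows "aff_dim (F m) + int m \<le> aff_dim K + 1"
  using assms(3,4)
proof (induction m rule: nat_induct_at_least)
  case base
  then have "F 1 \<subseteq> K"
    using assms(2) by (auto simp: face_chain_def cone_face_def)
  then show ?case
    by (simp add: aff_dim_subset)
next
  case (Suc m)
  have faces: "cone_face (F m) K" "cone_face (F (Suc m)) K" and less: "F (Suc m) \<subset> F m"
    using assms(2) Suc.hyps Suc.prems by (simp_all add: face_chain_def)
  have Fm: "F m \<subseteq> K" "convex (F m)"
    using faces(1) by (simp_all add: cone_face_def)
  have "F (Suc m) face_of F m"
    using cone_face_imp_face_of[OF assms(1) faces(2)] less Fm(1)
    by (rule face_of_subset[OF _ psubset_imp_subset])
  then have "aff_dim (F (Suc m)) < aff_dim (F m)"
    using less Fm(2) by (intro face_of_aff_dim_lt) auto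
  moreover have "aff_dim (F m) + int m \<le> aff_dim K + 1"
    using Suc.IH Suc.prems by simp
  ultimately show ?case
    by simp
qed

lemma face_chain_length_le:
  fixes K :: "'a::euclidean_space set"
  assumes "cone K" "K \<noteq> {}" "face_chain K l F"
  shows "int l \<le> aff_dim K + 1"
proof (cases "l = 0")
  case True
  \<comment> \<open>The empty chain has no last face, so the general bound on affine dimension is
    used instead.\<close>
  have "-1 \<le> aff_dim K"
    by (rule aff_dim_geq)
  then show ?thesis using True by simp
next
  case False
  then have "F l \<noteq> {}"
    using assms(3) by (auto simp: face_chain_def cone_face_def)
  then have "0 \<le> aff_dim (F l)"
    by (meson aff_dim_negative_iff not_less)
  with face_chain_aff_dim[OF assms(1,3), of l] False show ?thesis
    by simp
qed

text \<open>Counts the upper triangle row by row, both for the length of the constructed chain and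
  for the size of a spanning set.\<close>

lemma sum_lessThan_diff: "(\<Sum>k<n. n - k) = n * (n + 1) div (2::nat)"
proof (induction n)
  case (Suc n)
  have "(\<Sum>k<Suc n. Suc n - k) = Suc n + (\<Sum>k<n. n - k)"
    by (subst sum.lessThan_Suc_shift) simp
  with Suc.IH show ?case by simp
qed simp

lemma dim_sym_matrices_le:
  "dim (sym_matrices :: (real ^ 'n::finite ^ 'n) set) \<le> CARD('n) * (CARD('n) + 1) div 2"
proof -
  let ?n = "CARD('n)"
  obtain e :: "nat \<Rightarrow> 'n" where e: "bij_betw e {..<?n} UNIV"
    using ex_bij_betw_nat_finite[of "UNIV :: 'n set"] by (auto simp: atLeast0LessThan)
  \<comment> \<open>\<open>U x y\<close> is E_xy + E_yx, hence 2 E_xx on the diagonal. With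
    coefficients A_xy / 2 over all ordered pairs the sum is A, with no case distinction at the
    diagonal.\<close>
  define U :: "'n \<Rightarrow> 'n \<Rightarrow> real ^ 'n ^ 'n" where
    "U x y = (\<chi> a b. of_bool (a = x \<and> b = y) + of_bool (b = x \<and> a = y))" for x y
  define W where "W = (\<lambda>(i, j). U (e i) (e j)) ` (SIGMA i:{..<?n}. {i..<?n})"
  have U_W: "U x y \<in> W" for x y
  proof -
    have "x \<in> e ` {..<?n}" "y \<in> e ` {..<?n}"
      using bij_betw_imp_surj_on[OF e] by simp_all
    then obtain i j where ij: "i < ?n" "j < ?n" "x = e i" "y = e j"
      by auto
    have le: "U (e k) (e l) \<in> W" if "k \<le> l" "l < ?n" for k l
      unfolding W_def using that by (intro image_eqI[of _ _ "(k, l)"]) auto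
    \<comment> \<open>This symmetry lets pairs i \<le> j suffice in \<open>W\<close>, halving the
      count.\<close>
    have "U (e i) (e j) = U (e j) (e i)"
      by (simp add: U_def conj_commute add.commute)
    with le[of i j] le[of j i] ij show ?thesis
      by (metis linear)
  qed
  have "A \<in> span W" if "A \<in> sym_matrices" for A
  proof -
    have sym: "A $ a $ b = A $ b $ a" for a b
      using that by (auto simp: sym_matrices_def transpose_def vec_eq_iff)
    have delta: "(\<Sum>x\<in>UNIV. \<Sum>y\<in>UNIV. (g x y :: real) * of_bool (a = x \<and> b = y)) = g a b"
      for g and a b :: 'n
    proof -
      have "(\<Sum>y\<in>UNIV. g x y * of_bool (a = x \<and> b = y)) = (if a = x then g x b else 0)" for x
        by (simp add: of_bool_def if_distrib cong: if_cong)
      then show ?thesis by simp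
    qed
    have "A $ a $ b = (\<Sum>x\<in>UNIV. \<Sum>y\<in>UNIV. (A $ x $ y / 2) *\<^sub>R U x y) $ a $ b" for a b
    proof -
      have "(\<Sum>x\<in>UNIV. \<Sum>y\<in>UNIV. (A $ x $ y / 2) *\<^sub>R U x y) $ a $ b
          = (\<Sum>x\<in>UNIV. \<Sum>y\<in>UNIV. (A $ x $ y / 2) * of_bool (a = x \<and> b = y))
          + (\<Sum>x\<in>UNIV. \<Sum>y\<in>UNIV. (A $ x $ y / 2) * of_bool (b = x \<and> a = y))"
        by (simp only: U_def sum_component vector_scaleR_component vec_lambda_beta
            real_scaleR_def distrib_left sum.distrib)
      also have "\<dots> = A $ a $ b"
        unfolding delta using sym[of a b] by simp
      finally show ?thesis by simp
    qed
    then have "A = (\<Sum>x\<in>UNIV. \<Sum>y\<in>UNIV. (A $ x $ y / 2) *\<^sub>R U x y)"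
      unfolding vec_eq_iff by blast
    also have "\<dots> \<in> span W"
      by (intro span_sum span_scale span_base U_W)
    finally show ?thesis .
  qed
  then have "dim (sym_matrices :: (real ^ 'n ^ 'n) set) \<le> card W"
    by (intro dim_le_card) (auto simp: W_def)
  also have "\<dots> \<le> card (SIGMA i:{..<?n}. {i..<?n})"
    unfolding W_def by (intro card_image_le) auto
  also have "\<dots> = ?n * (?n + 1) div 2"
    using sum_lessThan_diff[of ?n] by simp
  finally show ?thesis .
qed

theorem proposition3p2:
  fixes K :: "(real ^ 'n::finite ^ 'n) set"
    and e :: "nat \<Rightarrow> 'n"
    and n :: nat
  assumes "n = CARD('n)"
    and "bij_betw e {1..n} (UNIV :: 'n set)"
    and "closed K" and "convex K" and "cone K"
    and "nonneg_diag_dominant \<subseteq> K"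
    and "K \<subseteq> nonneg_matrices"
  shows "(\<forall>i \<in> {1..n}. \<forall>j \<in> {i..n}. cone_face (vanishing_on e K (index_set n i j)) K)
    \<and> cone_face (vanishing_on e K (index_set n 0 0)) K
    \<and> (\<forall>i \<in> {1..n}. \<forall>j \<in> {i..n}.
          vanishing_on e K (index_set n i j) \<subset> vanishing_on e K (index_set n i (j + 1)))
    \<and> vanishing_on e K (index_set n 0 0) = K
    \<and> longest_face_chain K = enat (n * (n + 1) div 2 + 1)"
proof -
  let ?T = "n * (n + 1) div 2"
  have "K \<noteq> {}"
    using ones_block_in_nonneg_diag_dominant assms(6) by blast
  then have face: "cone_face (vanishing_on e K I) K" for I
    using assms by (intro cone_face_vanishing_on)
  have psubset: "vanishing_on e K (index_set n i j) \<subset> vanishing_on e K (index_set n i (j + 1))"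
    if "1 \<le> i" "i \<le> j" "j \<le> n" for i j
    using bij_betw_imp_inj_on[OF assms(2)] assms(6) that
    by (rule vanishing_on_index_set_psubset)
  have "\<exists>F. face_chain K (?T + 1) F"
    using face_chain_index_set[of e K n n, OF face psubset] by (auto simp: sum_lessThan_diff)
  moreover have "l \<le> ?T + 1" if "face_chain K l F" for l F
  proof -
    have "aff_dim K \<le> aff_dim (sym_matrices :: (real ^ 'n ^ 'n) set)"
      using assms(7) by (intro aff_dim_subset) (auto simp: nonneg_matrices_def)
    \<comment> \<open>The zero matrix is symmetric, so affine and linear dimension agree.\<close>
    also have "\<dots> = int (dim (sym_matrices :: (real ^ 'n ^ 'n) set))"
      by (intro aff_dim_zero hull_inc) (simp add: sym_matrices_def transpose_def vec_eq_iff)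
    also have "\<dots> \<le> int ?T"
      using dim_sym_matrices_le[where 'n = 'n] assms(1) by simp
    finally show ?thesis
      using face_chain_length_le[OF assms(5) \<open>K \<noteq> {}\<close> that] by linarith
  qed
  \<comment> \<open>The constructed chain attains the upper bound, so the supremum is finite and
    equal to it.\<close>
  ultimately have "longest_face_chain K = enat (?T + 1)"
    unfolding longest_face_chain_def by (intro antisym Sup_least Sup_upper) auto
  then show ?thesis
    using face face[of "{}"] psubset by (simp add: vanishing_on_empty)
qed

end
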